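(* There exist two universal constants $c_1,c_2>0$ such that the following holds. Let $n\ge 3$ be an integer, $\alpha\in(0,1]$, $a,b\in(0,1)$, $\epsilon\in\left(0,\min\left(a,\frac{1-a}{2},\frac14\right)\right)$ and $\delta\in\left(0,\frac14\right)$. Set $$T_1=c_1\,\frac{1-a}{\alpha^2a^4\epsilon^2}\,\ln\left(\frac{1}{4\delta}\right),\qquad T_2=c_2\,\frac{(1-a)^4(n-4)}{\alpha^2a^2b^2}\,\ln\left(\frac1{4\delta}\right).$$ Then for every integer $t\ge 1$ with $t\le\max(T_1,T_2)$ and every estimator $\hat\theta(t)$ of $\theta$ (any measurable $\mathbb{R}^n$-valued function of the observations $X(1),\dots,X(t)$, possibly depending on $\alpha$, which is known), $$\max_{\theta\in\Theta_{a,b}}\mathbb{P}_\theta\left(\|\hat\theta(t)-\theta\|_\infty\ge\epsilon\right)\ge\delta,$$ that is, there exists $\theta\in\Theta_{a,b}$ such that $\mathbb{P}_\theta\left(\|\hat\theta(t)-\theta\|_\infty\ge\epsilon\right)\ge\delta$.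
   Context: Model. There are $n\ge 3$ workers, a parameter $\alpha\in(0,1]$ and a reliability vector $\theta=(\theta_1,\dots,\theta_n)\in[-1,1]^n$. The ground truths $G(1),G(2),\dots$ are i.i.d. uniform on $\{-1,+1\}$. For each task $t$, given $G(t)$, the outputs $X_1(t),\dots,X_n(t)$ are independent with $X_i(t)=G(t)$ with probability $\alpha\frac{1+\theta_i}{2}$, $X_i(t)=-G(t)$ with probability $\alpha\frac{1-\theta_i}{2}$, and $X_i(t)=0$ with probability $1-\alpha$. The pairs $(G(t),X(t))$, with $X(t)=(X_1(t),\dots,X_n(t))$, are i.i.d. over $t$. Only the $X(t)$ are observed. $\mathbb{P}_\theta$ denotes probability under parameter $\theta$ (and $\alpha$). Notation. $\|\hat\theta-\theta\|_\infty=\max_{i}|\hat\theta_i-\theta_i|$. For $\theta\in[-1,1]^n$, $$A(\theta)=\min_{k}\ \max_{i,j\ne k,\ i\neq j}\sqrt{|\theta_i\theta_j|},\qquad B(\theta)=\sum_{i=1}^n\theta_i,$$ and for $a,b\in(0,1)$, $\Theta_{a,b}=\{\theta\in[-1,1]^n: A(\theta)\ge a,\ B(\theta)\ge b\}$. *)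

theory Defs
  imports "HOL-Probability.Probability"
begin

text \<open>
  A reliability vector is a function \<open>\<theta> :: nat \<Rightarrow> real\<close> of which only the values on \<open>{1..n}\<close> matter.
  \<open>pmf_of_list\<close> is meaningful only for lists of nonnegative weights summing to 1; lemma
  \<open>worker_pmf_wf\<close> checks this in the parameter range of the model.
\<close>

definition worker_pmf :: "real \<Rightarrow> real \<Rightarrow> int \<Rightarrow> int pmf" where
  "worker_pmf \<alpha> \<theta>\<^sub>i g =
     pmf_of_list [(g, \<alpha> * (1 + \<theta>\<^sub>i) / 2), (- g, \<alpha> * (1 - \<theta>\<^sub>i) / 2), (0, 1 - \<alpha>)]"

lemma worker_pmf_wf:
  fixes \<alpha> \<theta>\<^sub>i :: real and g :: int
  assumes "\<alpha> \<in> {0<..1}" "\<theta>\<^sub>i \<in> {-1..1}"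
  shows "pmf_of_list_wf [(g, \<alpha> * (1 + \<theta>\<^sub>i) / 2), (- g, \<alpha> * (1 - \<theta>\<^sub>i) / 2), (0, 1 - \<alpha>)]"
proof -
  have "\<alpha> * (1 + \<theta>\<^sub>i) / 2 \<ge> 0" "\<alpha> * (1 - \<theta>\<^sub>i) / 2 \<ge> 0" "1 - \<alpha> \<ge> 0"
    using assms by (auto intro!: divide_nonneg_nonneg mult_nonneg_nonneg)
  moreover have "\<alpha> * (1 + \<theta>\<^sub>i) / 2 + (\<alpha> * (1 - \<theta>\<^sub>i) / 2 + (1 - \<alpha>)) = 1"
    by (simp add: field_simps)
  ultimately show ?thesis
    unfolding pmf_of_list_wf_def by (simp del: zero_le_divide_iff zero_le_mult_iff)
qed

lemma pmf_worker_pmf: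
  assumes "\<alpha> \<in> {0<..1}" "\<theta>\<^sub>i \<in> {-1..1}" "g \<in> {-1, 1}"
  shows "pmf (worker_pmf \<alpha> \<theta>\<^sub>i g) g = \<alpha> * (1 + \<theta>\<^sub>i) / 2"
    and "pmf (worker_pmf \<alpha> \<theta>\<^sub>i g) (- g) = \<alpha> * (1 - \<theta>\<^sub>i) / 2"
    and "pmf (worker_pmf \<alpha> \<theta>\<^sub>i g) 0 = 1 - \<alpha>"
  using assms(3) unfolding worker_pmf_def pmf_pmf_of_list[OF worker_pmf_wf[OF assms(1,2)]]
  by auto

text \<open>The joint law of \<open>(G(t), X(t))\<close> for a single task; coordinates outside \<open>{1..n}\<close> are 0.\<close>

definition task_pmf :: "nat \<Rightarrow> real \<Rightarrow> (nat \<Rightarrow> real) \<Rightarrow> (int \<times> (nat \<Rightarrow> int)) pmf" where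
  "task_pmf n \<alpha> \<theta> =
     bind_pmf (pmf_of_set {-1, 1}) (\<lambda>g.
       map_pmf (\<lambda>x. (g, x)) (Pi_pmf {1..n} 0 (\<lambda>i. worker_pmf \<alpha> (\<theta> i) g)))"

text \<open>
  The joint law of the i.i.d. pairs \<open>(G(s), X(s))\<close>, \<open>s = 1, \<dots>, t\<close>. Indices outside \<open>{1..t}\<close> carry
  a constant, so a function of \<open>\<lambda>s. snd (\<omega> s)\<close> depends on \<open>X(1), \<dots>, X(t)\<close> only.
  The law is discrete, so every event and every such function is measurable.
\<close>

definition tasks_pmf ::
    "nat \<Rightarrow> real \<Rightarrow> (nat \<Rightarrow> real) \<Rightarrow> nat \<Rightarrow> (nat \<Rightarrow> int \<times> (nat \<Rightarrow> int)) pmf" where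
  "tasks_pmf n \<alpha> \<theta> t = Pi_pmf {1..t} (0, \<lambda>_. 0) (\<lambda>_. task_pmf n \<alpha> \<theta>)"

definition observations :: "(nat \<Rightarrow> int \<times> (nat \<Rightarrow> int)) \<Rightarrow> nat \<Rightarrow> nat \<Rightarrow> int" where
  "observations \<omega> = (\<lambda>s. snd (\<omega> s))"

definition linf_dist :: "nat \<Rightarrow> (nat \<Rightarrow> real) \<Rightarrow> (nat \<Rightarrow> real) \<Rightarrow> real" where
  "linf_dist n x y = (MAX i\<in>{1..n}. \<bar>x i - y i\<bar>)"

text \<open>For \<open>n \<ge> 3\<close> all the sets over which extrema are taken are finite and nonempty.\<close>

definition A_par :: "nat \<Rightarrow> (nat \<Rightarrow> real) \<Rightarrow> real" where
  "A_par n \<theta> =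
     (MIN k\<in>{1..n}. MAX (i, j)\<in>{(i, j). i \<in> {1..n} - {k} \<and> j \<in> {1..n} - {k} \<and> i \<noteq> j}.
        sqrt \<bar>\<theta> i * \<theta> j\<bar>)"

definition B_par :: "nat \<Rightarrow> (nat \<Rightarrow> real) \<Rightarrow> real" where
  "B_par n \<theta> = (\<Sum>i=1..n. \<theta> i)"

definition Theta :: "nat \<Rightarrow> real \<Rightarrow> real \<Rightarrow> (nat \<Rightarrow> real) set" where
  "Theta n a b = {\<theta>. (\<forall>i\<in>{1..n}. \<theta> i \<in> {-1..1}) \<and> A_par n \<theta> \<ge> a \<and> B_par n \<theta> \<ge> b}"

end

(* Each bound compares two parameters at distance at least 2 \<epsilon>, one of which every estimator
   must miss. Relative to the law of X for \<theta> = 0, a product of symmetric distributions, the law of X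
   has density L = (\<Prod>i (1 + \<theta>_i x_i) + \<Prod>i (1 - \<theta>_i x_i)) / 2, so the chi-square divergence of two
   parameters is the null expectation of (L' - L)^2 / L. If it is at most K, then the second moment
   of the likelihood ratio of t samples is at most exp (t K), and Cauchy-Schwarz bounds one
   probability of error by the other.

   The pairs are (1, a, a, 0, ...) and (1, a + 2 \<epsilon>, a, 0, ...) for T1 with a \<ge> 1/2;
   (1, a, a, 0, ...) and (q, a/q, a/q, 0, ...) with q = 1 - 2 \<epsilon> for T1 with a < 1/2, where only the
   correlation of workers 2 and 3 changes; and (a, a, -a, -a, r, ..., r) and
   (-a, -a, a, a, r, ..., r) with r = b / (n - 4) for T2, where only the weak workers reveal the
   global sign. *)

theory Submission
  imports Defs
begin

subsection \<open>Two-point lower bounds from the chi-square divergence\<close>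

text \<open>Cauchy-Schwarz for the sum of \<open>(f * sqrt p) * sqrt p\<close> over
  \<open>E\<close>; the first of the two resulting factors only grows when the sum is extended from
  \<open>E\<close> to the whole support.\<close>

lemma prob_sq_le_second_moment:
  fixes p q :: "'a pmf" and f :: "'a \<Rightarrow> real"
  assumes fin: "finite (set_pmf p)" and dens: "\<And>x. pmf q x = f x * pmf p x"
  shows "(measure_pmf.prob q E)\<^sup>2 \<le> measure_pmf.expectation p (\<lambda>x. (f x)\<^sup>2) * measure_pmf.prob p E"
proof -
  let ?S = "set_pmf p"
  have sub: "set_pmf q \<subseteq> ?S"
    using dens by (auto simp: set_pmf_eq)
  have q: "measure_pmf.prob q E = (\<Sum>x\<in>E \<inter> ?S. (f x * sqrt (pmf p x)) * sqrt (pmf p x))"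
  proof -
    have "measure_pmf.prob q E = measure_pmf.prob q (E \<inter> ?S)"
      by (rule measure_prob_cong_0) (use sub in \<open>auto simp: set_pmf_eq\<close>)
    also have "\<dots> = (\<Sum>x\<in>E \<inter> ?S. pmf q x)"
      using fin by (intro measure_measure_pmf_finite) auto
    also have "\<dots> = (\<Sum>x\<in>E \<inter> ?S. (f x * sqrt (pmf p x)) * sqrt (pmf p x))"
      by (intro sum.cong refl) (simp add: dens mult.assoc)
    finally show ?thesis .
  qed
  have "(measure_pmf.prob q E)\<^sup>2
      \<le> (\<Sum>x\<in>E \<inter> ?S. (f x * sqrt (pmf p x))\<^sup>2) * (\<Sum>x\<in>E \<inter> ?S. (sqrt (pmf p x))\<^sup>2)"
    unfolding q by (rule Cauchy_Schwarz_ineq_sum)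
  also have "\<dots> = (\<Sum>x\<in>E \<inter> ?S. (f x)\<^sup>2 * pmf p x) * measure_pmf.prob p E"
  proof -
    have "measure_pmf.prob p E = measure_pmf.prob p (E \<inter> ?S)"
      by (simp add: measure_Int_set_pmf)
    also have "\<dots> = (\<Sum>x\<in>E \<inter> ?S. pmf p x)"
      using fin by (intro measure_measure_pmf_finite) auto
    finally show ?thesis by (simp add: power_mult_distrib)
  qed
  also have "\<dots> \<le> (\<Sum>x\<in>?S. (f x)\<^sup>2 * pmf p x) * measure_pmf.prob p E"
    using fin by (intro mult_right_mono sum_mono2) auto
  also have "(\<Sum>x\<in>?S. (f x)\<^sup>2 * pmf p x) = measure_pmf.expectation p (\<lambda>x. (f x)\<^sup>2)"
    using fin by (subst integral_measure_pmf_real[of ?S]) auto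
  finally show ?thesis .
qed

text \<open>If \<open>P E < \<delta>\<close> then Cauchy-Schwarz gives \<open>Q E < 1/2\<close>, since the second moment of the
  likelihood ratio of \<open>t\<close> samples is at most \<open>(1 + K) ^ t \<le> 1 / (4 \<delta>)\<close>.\<close>

lemma two_point_iid:
  fixes p q :: "'a pmf" and f :: "'a \<Rightarrow> real"
  assumes fin: "finite (set_pmf p)" and dens: "\<And>x. pmf q x = f x * pmf p x"
    and moment: "measure_pmf.expectation p (\<lambda>x. (f x)\<^sup>2) \<le> 1 + K"
    and tK: "real t * K \<le> ln (1 / (4 * \<delta>))" and \<delta>: "0 < \<delta>" "\<delta> < 1 / 4"
    and cover: "E \<union> E' = UNIV"
  shows "measure_pmf.prob (Pi_pmf {1..t} d (\<lambda>_. p)) E \<ge> \<delta> \<or>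
         measure_pmf.prob (Pi_pmf {1..t} d (\<lambda>_. q)) E' \<ge> \<delta>"
proof (rule ccontr)
  define P where "P = Pi_pmf {1..t} d (\<lambda>_. p)"
  define Q where "Q = Pi_pmf {1..t} d (\<lambda>_. q)"
  define F where "F = (\<lambda>x. \<Prod>s\<in>{1..t}. f (x s))"
  assume "\<not> (measure_pmf.prob (Pi_pmf {1..t} d (\<lambda>_. p)) E \<ge> \<delta> \<or>
         measure_pmf.prob (Pi_pmf {1..t} d (\<lambda>_. q)) E' \<ge> \<delta>)"
  hence PE: "measure_pmf.prob P E < \<delta>" and QE': "measure_pmf.prob Q E' < \<delta>"
    by (auto simp: P_def Q_def)
  have finP: "finite (set_pmf P)"
    unfolding P_def using fin by (subst set_Pi_pmf) (auto intro!: finite_PiE_dflt)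
  have dens': "pmf Q x = F x * pmf P x" for x
  proof (cases "\<forall>s. s \<notin> {1..t} \<longrightarrow> x s = d")
    case True
    thus ?thesis
      unfolding P_def Q_def F_def by (subst (1 2) pmf_Pi') (auto simp: dens prod.distrib)
  next
    \<comment> \<open>At such a point both product laws give mass 0, whatever the value of
      \<open>F\<close>.\<close>
    case False
    hence "\<exists>s. s \<notin> {1..t} \<and> x s \<noteq> d" by blast
    from pmf_Pi_outside[OF _ this] show ?thesis
      by (simp add: P_def Q_def)
  qed
  have nonneg: "0 \<le> measure_pmf.expectation p (\<lambda>x. (f x)\<^sup>2)"
    by (intro Bochner_Integration.integral_nonneg) auto
  have "measure_pmf.expectation P (\<lambda>x. (F x)\<^sup>2) =
      measure_pmf.expectation P (\<lambda>x. \<Prod>s\<in>{1..t}. (f (x s))\<^sup>2)"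
    by (simp add: F_def prod_power_distrib)
  also have "\<dots> = measure_pmf.expectation p (\<lambda>x. (f x)\<^sup>2) ^ t"
    unfolding P_def using fin
    by (subst expectation_prod_Pi_pmf) (auto intro: integrable_measure_pmf_finite)
  also have "\<dots> \<le> exp K ^ t"
    using nonneg order.trans[OF moment exp_ge_add_one_self] by (intro power_mono)
  also have "\<dots> = exp (real t * K)"
    by (simp add: exp_of_nat_mult)
  also have "\<dots> \<le> exp (ln (1 / (4 * \<delta>)))"
    using tK by simp
  also have "\<dots> = 1 / (4 * \<delta>)"
    using \<delta> by simp
  finally have M: "measure_pmf.expectation P (\<lambda>x. (F x)\<^sup>2) \<le> 1 / (4 * \<delta>)" .
  have "(measure_pmf.prob Q E)\<^sup>2 \<le>
      measure_pmf.expectation P (\<lambda>x. (F x)\<^sup>2) * measure_pmf.prob P E"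
    using finP dens' by (rule prob_sq_le_second_moment)
  also have "\<dots> \<le> 1 / (4 * \<delta>) * measure_pmf.prob P E"
    using M by (intro mult_right_mono) auto
  \<comment> \<open>The 4 inside the logarithm makes this product 1/4, so \<open>Q\<close> gives
    \<open>E\<close> at most 1/2; together with less than 1/4 for \<open>E'\<close> this cannot
    cover the whole space.\<close>
  also have "\<dots> \<le> 1 / (4 * \<delta>) * \<delta>"
    using PE \<delta> by (intro mult_left_mono) auto
  also have "\<dots> = (1 / 2)\<^sup>2"
    using \<delta> by (simp add: power2_eq_square)
  finally have QE: "measure_pmf.prob Q E \<le> 1 / 2"
    by (rule power2_le_imp_le) simp
  have "1 = measure_pmf.prob Q (E \<union> E')"
    by (simp add: cover)
  also have "\<dots> \<le> measure_pmf.prob Q E + measure_pmf.prob Q E'"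
    by (rule measure_Un_le) auto
  finally show False
    using QE QE' \<delta> by simp
qed

lemma expectation_density:
  fixes p q :: "'a pmf" and l h :: "'a \<Rightarrow> real"
  assumes fin: "finite (set_pmf p)" and dens: "\<And>x. pmf q x = l x * pmf p x"
  shows "measure_pmf.expectation q h = measure_pmf.expectation p (\<lambda>x. l x * h x)"
proof -
  have sub: "set_pmf q \<subseteq> set_pmf p"
    using dens by (auto simp: set_pmf_eq)
  have "measure_pmf.expectation q h = (\<Sum>x\<in>set_pmf p. h x * pmf q x)"
    using fin sub by (intro integral_measure_pmf_real) auto
  also have "\<dots> = (\<Sum>x\<in>set_pmf p. (l x * h x) * pmf p x)"
    by (intro sum.cong refl) (simp add: dens)
  also have "\<dots> = measure_pmf.expectation p (\<lambda>x. l x * h x)"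
    using fin by (intro integral_measure_pmf_real[symmetric]) auto
  finally show ?thesis .
qed

text \<open>Integrate \<open>l'\<^sup>2 / l = l' + (l' - l) + (l' - l)\<^sup>2 / l\<close> against
  \<open>p0\<close>: both densities have total mass 1, which leaves 1 plus the chi-square
  divergence.\<close>

lemma second_moment_ratio:
  fixes p0 p q :: "'a pmf" and l l' :: "'a \<Rightarrow> real"
  assumes fin: "finite (set_pmf p0)"
    and p: "\<And>x. pmf p x = l x * pmf p0 x" and q: "\<And>x. pmf q x = l' x * pmf p0 x"
    and pos: "\<And>x. x \<in> set_pmf p0 \<Longrightarrow> 0 < l x"
  shows "measure_pmf.expectation p (\<lambda>x. (l' x / l x)\<^sup>2) =
         1 + measure_pmf.expectation p0 (\<lambda>x. (l' x - l x)\<^sup>2 / l x)"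
proof -
  have int: "integrable (measure_pmf p0) g" for g :: "'a \<Rightarrow> real"
    using fin by (rule integrable_measure_pmf_finite)
  have "measure_pmf.expectation p (\<lambda>x. (l' x / l x)\<^sup>2) =
      measure_pmf.expectation p0 (\<lambda>x. l x * (l' x / l x)\<^sup>2)"
    using fin p by (rule expectation_density)
  \<comment> \<open>The factors \<open>* 1\<close> give the terms the shape \<open>l x * h x\<close>
    with constant \<open>h\<close>, as in \<open>expectation_density\<close>.\<close>
  also have "\<dots> = measure_pmf.expectation p0 (\<lambda>x. l' x * 1 + (l' x * 1 - l x * 1) + (l' x - l x)\<^sup>2 / l x)"
  proof (intro integral_cong_AE AE_pmfI)
    fix x assume "x \<in> set_pmf p0"
    from pos[OF this] show "l x * (l' x / l x)\<^sup>2 =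
        l' x * 1 + (l' x * 1 - l x * 1) + (l' x - l x)\<^sup>2 / l x"
      by (simp add: field_simps power2_eq_square)
  qed auto
  also have "\<dots> = measure_pmf.expectation p0 (\<lambda>x. l' x * 1)
      + (measure_pmf.expectation p0 (\<lambda>x. l' x * 1) - measure_pmf.expectation p0 (\<lambda>x. l x * 1))
      + measure_pmf.expectation p0 (\<lambda>x. (l' x - l x)\<^sup>2 / l x)"
    using int by (simp only: Bochner_Integration.integral_add Bochner_Integration.integral_diff)
  also have "measure_pmf.expectation p0 (\<lambda>x. l' x * 1) = 1"
    by (subst expectation_density[OF fin q, symmetric]) simp
  also have "measure_pmf.expectation p0 (\<lambda>x. l x * 1) = 1"
    by (subst expectation_density[OF fin p, symmetric]) simp
  finally show ?thesis by simp
qed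

subsection \<open>The density of the observations\<close>

text \<open>Reliability 0 makes the outputs 1 and -1 equally likely, so this reference law is the
  same for both ground truths.\<close>

definition worker_null :: "real \<Rightarrow> int pmf" where
  "worker_null \<alpha> = worker_pmf \<alpha> 0 1"

definition obs_null :: "nat \<Rightarrow> real \<Rightarrow> (nat \<Rightarrow> int) pmf" where
  "obs_null n \<alpha> = Pi_pmf {1..n} 0 (\<lambda>_. worker_null \<alpha>)"

definition obs_pmf :: "nat \<Rightarrow> real \<Rightarrow> (nat \<Rightarrow> real) \<Rightarrow> (nat \<Rightarrow> int) pmf" where
  "obs_pmf n \<alpha> \<theta> = map_pmf snd (task_pmf n \<alpha> \<theta>)"

text \<open>Density, relative to \<open>obs_null\<close>, of the outputs given ground truth 1.
  Ground truth -1 has the effect of negating \<theta>, so \<open>obs_dens\<close> averages the two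
  cases.\<close>

definition half_dens :: "nat \<Rightarrow> (nat \<Rightarrow> real) \<Rightarrow> (nat \<Rightarrow> int) \<Rightarrow> real" where
  "half_dens n \<theta> x = (\<Prod>i\<in>{1..n}. 1 + \<theta> i * of_int (x i))"

definition obs_dens :: "nat \<Rightarrow> (nat \<Rightarrow> real) \<Rightarrow> (nat \<Rightarrow> int) \<Rightarrow> real" where
  "obs_dens n \<theta> x = (half_dens n \<theta> x + half_dens n (\<lambda>i. - \<theta> i) x) / 2"

context
  fixes \<alpha> :: real
  assumes \<alpha>: "\<alpha> \<in> {0<..1}"
begin

lemma pmf_worker_pmf_cases:
  assumes "c \<in> {-1..1}" "g \<in> {-1, 1}"
  shows "pmf (worker_pmf \<alpha> c g) y =
    (if y = g then \<alpha> * (1 + c) / 2 else if y = - g then \<alpha> * (1 - c) / 2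
     else if y = 0 then 1 - \<alpha> else 0)"
  using assms(2) unfolding worker_pmf_def pmf_pmf_of_list[OF worker_pmf_wf[OF \<alpha> assms(1)]]
  by auto

text \<open>A missing answer carries no information, so the factor is 1 at \<open>y = 0\<close>; the
  answers 1 and -1 are tilted by \<open>g * c\<close> in opposite directions.\<close>

lemma pmf_worker_pmf_null:
  assumes "c \<in> {-1..1}" "g \<in> {-1, 1}"
  shows "pmf (worker_pmf \<alpha> c g) y = (1 + of_int g * c * of_int y) * pmf (worker_null \<alpha>) y"
proof -
  have "pmf (worker_null \<alpha>) y =
      (if y = 1 then \<alpha> / 2 else if y = - 1 then \<alpha> / 2 else if y = 0 then 1 - \<alpha> else 0)"
    unfolding worker_null_def by (subst pmf_worker_pmf_cases) auto
  thus ?thesis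
    using assms(2) by (auto simp: pmf_worker_pmf_cases[OF assms] field_simps)
qed

lemma set_worker_null: "set_pmf (worker_null \<alpha>) \<subseteq> {-1, 0, 1}"
proof -
  have "pmf_of_list_wf [(1, \<alpha> * (1 + 0) / 2), (- 1, \<alpha> * (1 - 0) / 2), (0::int, 1 - \<alpha>)]"
    using \<alpha> by (intro worker_pmf_wf) auto
  from set_pmf_of_list[OF this] show ?thesis
    unfolding worker_null_def worker_pmf_def by auto
qed

lemma expectation_worker_null:
  "measure_pmf.expectation (worker_null \<alpha>) h = \<alpha> / 2 * (h 1 + h (-1)) + (1 - \<alpha>) * h 0" for h :: "int \<Rightarrow> real"
proof -
  have "measure_pmf.expectation (worker_null \<alpha>) h = (\<Sum>y\<in>{-1,0,1}. h y * pmf (worker_null \<alpha>) y)"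
    using set_worker_null by (intro integral_measure_pmf_real) auto
  also have "\<dots> = h (-1) * pmf (worker_null \<alpha>) (-1) + h 0 * pmf (worker_null \<alpha>) 0
      + h 1 * pmf (worker_null \<alpha>) 1"
    by simp
  also have "\<dots> = \<alpha> / 2 * (h 1 + h (-1)) + (1 - \<alpha>) * h 0"
  proof -
    have pmfs: "pmf (worker_null \<alpha>) 1 = \<alpha> / 2" "pmf (worker_null \<alpha>) (-1) = \<alpha> / 2"
      "pmf (worker_null \<alpha>) 0 = 1 - \<alpha>"
      using pmf_worker_pmf[OF \<alpha>, of 0 1] by (simp_all add: worker_null_def)
    show ?thesis unfolding pmfs by (simp add: algebra_simps)
  qed
  finally show ?thesis .
qed

lemma obs_null_range: "x \<in> set_pmf (obs_null n \<alpha>) \<Longrightarrow> x i \<in> {-1, 0, 1}"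
  using set_worker_null unfolding obs_null_def
  by (cases "i \<in> {1..n}") (auto simp: set_Pi_pmf PiE_dflt_def)

lemma finite_obs_null: "finite (set_pmf (obs_null n \<alpha>))"
  unfolding obs_null_def using finite_subset[OF set_worker_null]
  by (subst set_Pi_pmf) (auto intro!: finite_PiE_dflt)

lemma expectation_obs_null_prod:
  fixes f :: "nat \<Rightarrow> int \<Rightarrow> real"
  assumes "\<And>i y. i \<in> {1..n} \<Longrightarrow> y \<in> {-1, 0, 1} \<Longrightarrow> 0 \<le> f i y"
  shows "measure_pmf.expectation (obs_null n \<alpha>) (\<lambda>x. \<Prod>i\<in>{1..n}. f i (x i)) =
    (\<Prod>i\<in>{1..n}. \<alpha> / 2 * (f i 1 + f i (-1)) + (1 - \<alpha>) * f i 0)"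
  unfolding obs_null_def using set_worker_null assms
  by (subst expectation_prod_Pi_pmf)
     (auto simp: expectation_worker_null intro!: integrable_measure_pmf_finite finite_subset[OF set_worker_null])

lemma pmf_obs_pmf:
  assumes "\<And>i. i \<in> {1..n} \<Longrightarrow> \<theta> i \<in> {-1..1}"
  shows "pmf (obs_pmf n \<alpha> \<theta>) x = obs_dens n \<theta> x * pmf (obs_null n \<alpha>) x"
proof -
  \<comment> \<open>Given \<open>g\<close> the outputs are independent, so the worker densities
    multiply; averaging over \<open>g\<close> then yields \<open>obs_dens\<close>.\<close>
  have half: "pmf (Pi_pmf {1..n} 0 (\<lambda>i. worker_pmf \<alpha> (\<theta> i) g)) x =
      half_dens n (\<lambda>i. of_int g * \<theta> i) x * pmf (obs_null n \<alpha>) x" if "g \<in> {-1, 1}" for g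
    unfolding obs_null_def half_dens_def
    using that assms by (auto simp: pmf_Pi prod.distrib[symmetric] pmf_worker_pmf_null intro!: prod.cong)
  have "obs_pmf n \<alpha> \<theta> = bind_pmf (pmf_of_set {-1, 1}) (\<lambda>g. Pi_pmf {1..n} 0 (\<lambda>i. worker_pmf \<alpha> (\<theta> i) g))"
    by (simp add: obs_pmf_def task_pmf_def map_bind_pmf pmf.map_comp o_def)
  hence "pmf (obs_pmf n \<alpha> \<theta>) x =
      (\<Sum>g\<in>{-1, 1}. pmf (Pi_pmf {1..n} 0 (\<lambda>i. worker_pmf \<alpha> (\<theta> i) g)) x) / 2"
    by (simp add: pmf_bind_pmf_of_set)
  also have "\<dots> = obs_dens n \<theta> x * pmf (obs_null n \<alpha>) x"
    using half[of 1] half[of "-1"] by (simp add: obs_dens_def algebra_simps add_divide_distrib)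
  finally show ?thesis .
qed

text \<open>An estimator sees only the outputs, whose law is again a product over tasks; this makes
  \<open>two_point_iid\<close> applicable to \<open>obs_pmf\<close>.\<close>

lemma observations_tasks_pmf:
  "map_pmf observations (tasks_pmf n \<alpha> \<theta> t) = Pi_pmf {1..t} (\<lambda>_. 0) (\<lambda>_. obs_pmf n \<alpha> \<theta>)"
  unfolding tasks_pmf_def obs_pmf_def observations_def
  by (subst Pi_pmf_map[where dflt = "(0, \<lambda>_. 0)"]) (auto simp: o_def intro!: map_pmf_cong)

lemma linf_dist_ge: "i \<in> {1..n} \<Longrightarrow> \<bar>x i - y i\<bar> \<le> linf_dist n x y"
  unfolding linf_dist_def by (intro Max_ge) auto

text \<open>The common reduction for both bounds. The chi-square integrand is replaced by a majorant
  \<open>h\<close>, to be chosen so that its null expectation is tractable in spite of the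
  denominator.\<close>

lemma two_parameters:
  fixes est :: "(nat \<Rightarrow> nat \<Rightarrow> int) \<Rightarrow> nat \<Rightarrow> real"
  assumes \<theta>: "\<theta> \<in> Theta n a b" and \<theta>': "\<theta>' \<in> Theta n a b"
    and sep: "i \<in> {1..n}" "2 * \<epsilon> \<le> \<bar>\<theta> i - \<theta>' i\<bar>"
    and pos: "\<And>x. x \<in> set_pmf (obs_null n \<alpha>) \<Longrightarrow> 0 < obs_dens n \<theta> x"
    and bound: "\<And>x. x \<in> set_pmf (obs_null n \<alpha>) \<Longrightarrow>
      (obs_dens n \<theta>' x - obs_dens n \<theta> x)\<^sup>2 / obs_dens n \<theta> x \<le> h x"
    and h: "measure_pmf.expectation (obs_null n \<alpha>) h \<le> K"
    and tK: "real t * K \<le> ln (1 / (4 * \<delta>))" and \<delta>: "0 < \<delta>" "\<delta> < 1 / 4"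
  shows "\<exists>\<theta>\<in>Theta n a b. measure_pmf.prob (tasks_pmf n \<alpha> \<theta> t)
           {\<omega>. linf_dist n (est (observations \<omega>)) \<theta> \<ge> \<epsilon>} \<ge> \<delta>"
proof -
  define E where "E = (\<lambda>\<theta>. {x. linf_dist n (est x) \<theta> \<ge> \<epsilon>})"
  have prob: "measure_pmf.prob (tasks_pmf n \<alpha> \<theta> t) {\<omega>. linf_dist n (est (observations \<omega>)) \<theta> \<ge> \<epsilon>}
      = measure_pmf.prob (Pi_pmf {1..t} (\<lambda>_. 0) (\<lambda>_. obs_pmf n \<alpha> \<theta>)) (E \<theta>)" for \<theta>
    unfolding observations_tasks_pmf[symmetric] by (simp add: E_def vimage_def)
  have cover: "E \<theta> \<union> E \<theta>' = UNIV"
  proof -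
    \<comment> \<open>Two errors below \<epsilon> would contradict the separation in coordinate
      \<open>i\<close> by the triangle inequality.\<close>
    have "\<epsilon> \<le> linf_dist n (est x) \<theta> \<or> \<epsilon> \<le> linf_dist n (est x) \<theta>'" for x
      using linf_dist_ge[OF sep(1), of "est x" \<theta>] linf_dist_ge[OF sep(1), of "est x" \<theta>'] sep(2)
      by linarith
    thus ?thesis by (auto simp: E_def)
  qed
  let ?p = "obs_pmf n \<alpha> \<theta>" and ?q = "obs_pmf n \<alpha> \<theta>'"
  note [simp] = finite_obs_null
  have p: "pmf ?p x = obs_dens n \<theta> x * pmf (obs_null n \<alpha>) x" for x
    using \<theta> by (intro pmf_obs_pmf) (auto simp: Theta_def)
  have q: "pmf ?q x = obs_dens n \<theta>' x * pmf (obs_null n \<alpha>) x" for x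
    using \<theta>' by (intro pmf_obs_pmf) (auto simp: Theta_def)
  \<comment> \<open>Outside the support of \<open>obs_null\<close> both laws vanish; inside it the
    denominator is positive.\<close>
  have qp: "pmf ?q x = obs_dens n \<theta>' x / obs_dens n \<theta> x * pmf ?p x" for x
    using pos[of x] p q by (cases "x \<in> set_pmf (obs_null n \<alpha>)") (auto simp: set_pmf_eq)
  have "set_pmf ?p \<subseteq> set_pmf (obs_null n \<alpha>)"
    using p by (auto simp: set_pmf_eq)
  hence fin: "finite (set_pmf ?p)"
    by (rule finite_subset) simp
  have "measure_pmf.expectation ?p (\<lambda>x. (obs_dens n \<theta>' x / obs_dens n \<theta> x)\<^sup>2) = 1 +
      measure_pmf.expectation (obs_null n \<alpha>)
        (\<lambda>x. (obs_dens n \<theta>' x - obs_dens n \<theta> x)\<^sup>2 / obs_dens n \<theta> x)"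
    using p q pos by (intro second_moment_ratio) auto
  also have "measure_pmf.expectation (obs_null n \<alpha>)
        (\<lambda>x. (obs_dens n \<theta>' x - obs_dens n \<theta> x)\<^sup>2 / obs_dens n \<theta> x)
      \<le> measure_pmf.expectation (obs_null n \<alpha>) h"
    using bound by (intro integral_mono_AE AE_pmfI integrable_measure_pmf_finite) auto
  also have "\<dots> \<le> K"
    by (rule h)
  finally have "measure_pmf.expectation ?p (\<lambda>x. (obs_dens n \<theta>' x / obs_dens n \<theta> x)\<^sup>2) \<le> 1 + K"
    by simp
  from two_point_iid[OF fin qp this tK \<delta> cover] show ?thesis
    using \<theta> \<theta>' unfolding prob by blast
qed

end

section \<open>Membership in \<open>Theta\<close> and moments under the null law\<close>

lemma ThetaI:
  assumes n: "n \<ge> 1" and range: "\<And>i. i \<in> {1..n} \<Longrightarrow> \<theta> i \<in> {-1..1}"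
    and pairs: "\<And>k. k \<in> {1..n} \<Longrightarrow> \<exists>i j. i \<in> {1..n} - {k} \<and> j \<in> {1..n} - {k} \<and> i \<noteq> j \<and> a\<^sup>2 \<le> \<bar>\<theta> i * \<theta> j\<bar>"
    and sum: "b \<le> (\<Sum>i=1..n. \<theta> i)"
  shows "\<theta> \<in> Theta n a b"
proof -
  \<comment> \<open>For each removed worker \<open>k\<close>, a single good pair among the others
    bounds the inner maximum from below.\<close>
  have "a \<le> (MAX (i, j)\<in>{(i, j). i \<in> {1..n} - {k} \<and> j \<in> {1..n} - {k} \<and> i \<noteq> j}. sqrt \<bar>\<theta> i * \<theta> j\<bar>)"
    if k: "k \<in> {1..n}" for k
  proof -
    let ?S = "{(i, j). i \<in> {1..n} - {k} \<and> j \<in> {1..n} - {k} \<and> i \<noteq> j}"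
    have fin: "finite ?S"
      by (rule finite_subset[of _ "{1..n} \<times> {1..n}"]) auto
    obtain i j where ij: "(i, j) \<in> ?S" "a\<^sup>2 \<le> \<bar>\<theta> i * \<theta> j\<bar>"
      using pairs[OF k] by blast
    have "a \<le> sqrt \<bar>\<theta> i * \<theta> j\<bar>"
      using ij(2) by (rule real_le_rsqrt)
    also have "\<dots> \<le> (MAX (i, j)\<in>?S. sqrt \<bar>\<theta> i * \<theta> j\<bar>)"
      using fin ij(1) by (intro Max_ge) (auto intro!: image_eqI[of _ _ "(i, j)"])
    finally show ?thesis .
  qed
  hence "a \<le> A_par n \<theta>"
    using n unfolding A_par_def by (subst Min_ge_iff) auto
  thus ?thesis
    using range sum by (simp add: Theta_def B_par_def)
qed

text \<open>The outputs are independent, and the square of one output has mean \<alpha>, the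
  probability of an answer; each worker in \<open>J\<close> contributes the same mean of
  \<open>c\<close>.\<close>

lemma expectation_sq_prod:
  fixes c :: "int \<Rightarrow> real"
  assumes \<alpha>: "\<alpha> \<in> {0<..1}" and J: "J \<subseteq> {1..n}" and i: "i \<in> {1..n} - J"
    and c: "\<And>y. y \<in> {-1, 0, 1} \<Longrightarrow> 0 \<le> c y"
  shows "measure_pmf.expectation (obs_null n \<alpha>) (\<lambda>x. (of_int (x i))\<^sup>2 * (\<Prod>j\<in>J. c (x j))) =
    \<alpha> * (\<alpha> / 2 * (c 1 + c (-1)) + (1 - \<alpha>) * c 0) ^ card J"
proof -
  \<comment> \<open>Workers outside \<open>insert i J\<close> get the constant factor 1, so that the
    product runs over all workers.\<close>
  define f :: "nat \<Rightarrow> int \<Rightarrow> real" where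
    "f = (\<lambda>k y. if k = i then (of_int y)\<^sup>2 else if k \<in> J then c y else 1)"
  have finJ: "finite J"
    using J by (rule finite_subset) simp
  have restrict: "(\<Prod>k\<in>{1..n}. g k) = g i * (\<Prod>j\<in>J. g j)"
    if "\<And>k. k \<in> {1..n} - insert i J \<Longrightarrow> g k = 1" for g :: "nat \<Rightarrow> real"
  proof -
    have "(\<Prod>k\<in>{1..n}. g k) = (\<Prod>k\<in>insert i J. g k)"
      using J i that by (intro prod.mono_neutral_right) auto
    thus ?thesis using i finJ by simp
  qed
  have "(of_int (x i))\<^sup>2 * (\<Prod>j\<in>J. c (x j)) = (\<Prod>k\<in>{1..n}. f k (x k))" for x :: "nat \<Rightarrow> int"
  proof -
    have "(\<Prod>j\<in>J. c (x j)) = (\<Prod>j\<in>J. f j (x j))"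
      using i by (intro prod.cong) (auto simp: f_def)
    thus ?thesis by (subst restrict) (auto simp: f_def)
  qed
  hence "measure_pmf.expectation (obs_null n \<alpha>) (\<lambda>x. (of_int (x i))\<^sup>2 * (\<Prod>j\<in>J. c (x j))) =
      measure_pmf.expectation (obs_null n \<alpha>) (\<lambda>x. \<Prod>k\<in>{1..n}. f k (x k))"
    by presburger
  also have "\<dots> = (\<Prod>k\<in>{1..n}. \<alpha> / 2 * (f k 1 + f k (-1)) + (1 - \<alpha>) * f k 0)"
    using c by (intro expectation_obs_null_prod[OF \<alpha>]) (auto simp: f_def)
  also have "\<dots> = \<alpha> * (\<Prod>j\<in>J. \<alpha> / 2 * (f j 1 + f j (-1)) + (1 - \<alpha>) * f j 0)"
    by (subst restrict) (auto simp: f_def algebra_simps)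
  also have "(\<Prod>j\<in>J. \<alpha> / 2 * (f j 1 + f j (-1)) + (1 - \<alpha>) * f j 0) =
      (\<Prod>j\<in>J. \<alpha> / 2 * (c 1 + c (-1)) + (1 - \<alpha>) * c 0)"
    using i by (intro prod.cong) (auto simp: f_def)
  finally show ?thesis by simp
qed

text \<open>On the support the integrand indicates that both workers answer; this is the source of
  the factor \<open>\<alpha>\<^sup>2\<close> in the first bound.\<close>

lemma expectation_sq_sq:
  assumes "\<alpha> \<in> {0<..1}" "i \<in> {1..n}" "j \<in> {1..n}" "i \<noteq> j"
  shows "measure_pmf.expectation (obs_null n \<alpha>) (\<lambda>x. (of_int (x i))\<^sup>2 * (of_int (x j))\<^sup>2 :: real) = \<alpha>\<^sup>2"
  using expectation_sq_prod[OF assms(1), of "{j}" n i "\<lambda>y. (of_int y)\<^sup>2"] assms(2-)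
  by (simp add: power2_eq_square)

subsection \<open>Estimating reliabilities from three workers\<close>

definition vec3 :: "real \<Rightarrow> real \<Rightarrow> real \<Rightarrow> nat \<Rightarrow> real" where
  "vec3 u v w = (\<lambda>i. if i = 1 then u else if i = 2 then v else if i = 3 then w else 0)"

text \<open>Removing one worker leaves at least two of the first three, and any two of their
  reliabilities have product at least \<open>a\<^sup>2\<close>.\<close>

lemma vec3_in_Theta:
  assumes n: "n \<ge> 3" and a: "0 < a" and uvw: "u \<in> {a..1}" "v \<in> {a..1}" "w \<in> {a..1}"
    and b: "b \<le> u + v + w"
  shows "vec3 u v w \<in> Theta n a b"
proof (rule ThetaI)
  have "a\<^sup>2 \<le> u * v" "a\<^sup>2 \<le> u * w" "a\<^sup>2 \<le> v * w"
    using a uvw by (auto simp: power2_eq_square intro!: mult_mono)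
  hence vec: "a\<^sup>2 \<le> \<bar>vec3 u v w i * vec3 u v w j\<bar>" if "(i, j) \<in> {(1,2),(1,3),(2,3)}" for i j
    using that by (auto simp: vec3_def)
  show "\<exists>i j. i \<in> {1..n} - {k} \<and> j \<in> {1..n} - {k} \<and> i \<noteq> j \<and> a\<^sup>2 \<le> \<bar>vec3 u v w i * vec3 u v w j\<bar>" for k
  proof -
    consider "k = 1" | "k = 2" | "k \<noteq> 1" "k \<noteq> 2" by blast
    thus ?thesis
    proof cases
      case 1 thus ?thesis using vec[of 2 3] n by (intro exI[of _ 2] exI[of _ 3]) auto
    next
      case 2 thus ?thesis using vec[of 1 3] n by (intro exI[of _ 1] exI[of _ 3]) auto
    next
      case 3 thus ?thesis using vec[of 1 2] n by (intro exI[of _ 1] exI[of _ 2]) auto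
    qed
  qed
  have "(\<Sum>i=1..n. vec3 u v w i) = (\<Sum>i\<in>{1,2,3}. vec3 u v w i)"
    using n by (intro sum.mono_neutral_right) (auto simp: vec3_def)
  also have "\<dots> = u + v + w"
    by (simp add: vec3_def)
  finally show "b \<le> (\<Sum>i=1..n. vec3 u v w i)"
    using b by simp
qed (use n a uvw in \<open>auto simp: vec3_def\<close>)

text \<open>Terms of odd degree in the outputs cancel between the two ground truths, so only the
  pairwise correlations remain.\<close>

lemma obs_dens_vec3:
  assumes "n \<ge> 3"
  shows "obs_dens n (vec3 u v w) x =
    1 + u * v * of_int (x 1 * x 2) + u * w * of_int (x 1 * x 3) + v * w * of_int (x 2 * x 3)"
proof -
  have half: "half_dens n \<theta> x = (\<Prod>i\<in>{1,2,3}. 1 + \<theta> i * of_int (x i))"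
    if "\<And>i. i \<notin> {1,2,3} \<Longrightarrow> \<theta> i = 0" for \<theta>
    unfolding half_dens_def using assms that by (intro prod.mono_neutral_right) auto
  show ?thesis
    unfolding obs_dens_def by (subst (1 2) half) (auto simp: vec3_def field_simps)
qed

text \<open>The minimum is attained at nonzero \<open>y = z = - x\<close>, with value
  \<open>1 - 2 * a + a\<^sup>2\<close>.\<close>

lemma vec3_dens_lower:
  fixes a x y z :: real
  assumes a: "0 < a" "a < 1" and xyz: "x \<in> {-1,0,1}" "y \<in> {-1,0,1}" "z \<in> {-1,0,1}"
  shows "(1 - a)\<^sup>2 \<le> 1 + a * (x * y) + a * (x * z) + a * a * (y * z)"
proof -
  have "a\<^sup>2 \<le> a" using a by (simp add: power2_eq_square)
  hence "0 \<le> a - a\<^sup>2" "0 < a\<^sup>2" using a by auto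
  thus ?thesis
    using xyz a by (auto simp: power2_eq_square algebra_simps)
qed

text \<open>Bounding the density below on its own would cost \<open>(1 - a)\<^sup>2\<close>. Where
  it is that small, at nonzero \<open>y = z = - x\<close>, the square on the left is
  \<open>(1 - a)\<^sup>2\<close> too; so only one factor \<open>1 - a\<close> is lost, as at
  \<open>z = 0\<close>, \<open>x * y = -1\<close>.\<close>

lemma vec3_dens_upper:
  fixes a x y z :: real
  assumes a: "0 < a" "a < 1" and xyz: "x \<in> {-1,0,1}" "y \<in> {-1,0,1}" "z \<in> {-1,0,1}"
  shows "(x * y + a * (y * z))\<^sup>2 * (1 - a) \<le>
    2 * (1 + a * (x * y) + a * (x * z) + a * a * (y * z)) * (x\<^sup>2 * y\<^sup>2 + z\<^sup>2 * y\<^sup>2)"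
proof -
  have "a\<^sup>2 \<le> a" using a by (simp add: power2_eq_square)
  \<comment> \<open>Differences of the two sides, in factored form, for the critical sign
    patterns.\<close>
  hence "0 \<le> (1 - a) * (3 + 6 * a - a\<^sup>2)" "0 \<le> (1 - a) * (3 + 2 * a - a\<^sup>2)"
    "0 \<le> (1 - a) * (2 + 2 * a - a\<^sup>2)" "0 \<le> (1 - a)\<^sup>2 * (3 + a)"
    using a by (auto intro!: mult_nonneg_nonneg)
  thus ?thesis
    using xyz a by (auto simp: power2_eq_square power3_eq_cube algebra_simps)
qed

subsection \<open>Resolving the sign from many weak workers\<close>

text \<open>The two strong pairs cancel in \<open>B_par\<close>, which the weak workers must then
  supply alone, and after the removal of any worker an intact pair remains for
  \<open>A_par\<close>.\<close>

definition vec4 :: "real \<Rightarrow> real \<Rightarrow> nat \<Rightarrow> real" where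
  "vec4 a r = (\<lambda>i. if i \<in> {1, 2} then a else if i \<in> {3, 4} then - a else r)"

lemma prod_split4:
  fixes f :: "nat \<Rightarrow> 'a::comm_monoid_mult"
  assumes "n \<ge> 5"
  shows "(\<Prod>i\<in>{1..n}. f i) = f 1 * f 2 * f 3 * f 4 * (\<Prod>i\<in>{5..n}. f i)"
proof -
  have "{1..n} = {1, 2, 3, 4} \<union> {5..n}"
    using assms by auto
  hence "(\<Prod>i\<in>{1..n}. f i) = (\<Prod>i\<in>{1, 2, 3, 4}. f i) * (\<Prod>i\<in>{5..n}. f i)"
    by (simp only:) (rule prod.union_disjoint; auto)
  thus ?thesis by (simp add: mult.assoc)
qed

lemma sum_split4:
  fixes f :: "nat \<Rightarrow> 'a::comm_monoid_add"
  assumes "n \<ge> 5"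
  shows "(\<Sum>i\<in>{1..n}. f i) = f 1 + f 2 + f 3 + f 4 + (\<Sum>i\<in>{5..n}. f i)"
proof -
  have "{1..n} = {1, 2, 3, 4} \<union> {5..n}"
    using assms by auto
  hence "(\<Sum>i\<in>{1..n}. f i) = (\<Sum>i\<in>{1, 2, 3, 4}. f i) + (\<Sum>i\<in>{5..n}. f i)"
    by (simp only:) (rule sum.union_disjoint; auto)
  thus ?thesis by (simp add: add.assoc)
qed

lemma vec4_in_Theta:
  assumes n: "n \<ge> 5" and a: "\<bar>c\<bar> = a" "a \<le> 1" and b: "b \<le> real (n - 4) * r" and r: "r \<in> {-1..1}"
  shows "vec4 c r \<in> Theta n a b"
proof (rule ThetaI)
  have vec: "a\<^sup>2 \<le> \<bar>vec4 c r i * vec4 c r j\<bar>" if "i \<in> {1, 2, 3, 4}" "j \<in> {1, 2, 3, 4}" for i j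
    using that a(1)[symmetric] by (auto simp: vec4_def abs_mult power2_eq_square)
  show "\<exists>i j. i \<in> {1..n} - {k} \<and> j \<in> {1..n} - {k} \<and> i \<noteq> j \<and> a\<^sup>2 \<le> \<bar>vec4 c r i * vec4 c r j\<bar>" for k
  proof (cases "k \<in> {1, 2}")
    case True
    thus ?thesis using vec[of 3 4] n by (intro exI[of _ 3] exI[of _ 4]) auto
  next
    case False
    thus ?thesis using vec[of 1 2] n by (intro exI[of _ 1] exI[of _ 2]) auto
  qed
  have "(\<Sum>i\<in>{5..n}. vec4 c r i) = (\<Sum>i\<in>{5..n}. r)"
    by (intro sum.cong) (auto simp: vec4_def)
  also have "\<dots> = real (n - 4) * r"
    using n by (simp add: Suc_diff_le[symmetric])
  finally show "b \<le> (\<Sum>i=1..n. vec4 c r i)"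
    using b n by (simp only: sum_split4) (simp add: vec4_def)
qed (use n a r in \<open>auto simp: vec4_def\<close>)

definition quad_dens :: "real \<Rightarrow> (nat \<Rightarrow> int) \<Rightarrow> real" where
  "quad_dens a x = (1 + a * of_int (x 1)) * (1 + a * of_int (x 2)) *
     (1 - a * of_int (x 3)) * (1 - a * of_int (x 4))"

definition tail_dens :: "nat \<Rightarrow> real \<Rightarrow> (nat \<Rightarrow> int) \<Rightarrow> real" where
  "tail_dens n r x = (\<Prod>i\<in>{5..n}. 1 + r * of_int (x i))"

text \<open>Changing the ground truth negates both \<open>a\<close> and \<open>r\<close>. Hence
  replacing \<open>a\<close> by \<open>- a\<close> alone exchanges the two strong factors of the
  mixture, the situation of \<open>swapped_mixture_bound\<close>.\<close>

lemma obs_dens_vec4: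
  assumes n: "n \<ge> 5"
  shows "obs_dens n (vec4 a r) x =
    (quad_dens a x * tail_dens n r x + quad_dens (- a) x * tail_dens n (- r) x) / 2"
proof -
  have "half_dens n (vec4 a r) x = quad_dens a x * tail_dens n r x" for a r
  proof -
    have "(\<Prod>i\<in>{5..n}. 1 + vec4 a r i * of_int (x i)) = tail_dens n r x"
      unfolding tail_dens_def by (intro prod.cong) (auto simp: vec4_def)
    thus ?thesis
      unfolding half_dens_def quad_dens_def using n
      by (simp only: prod_split4) (simp add: vec4_def)
  qed
  moreover have "(\<lambda>i. - vec4 a r i) = vec4 (- a) (- r)"
    by (auto simp: vec4_def)
  ultimately show ?thesis
    by (simp add: obs_dens_def)
qed

lemma quad_dens_lower:
  assumes a: "\<bar>c\<bar> = a" "a < 1" and x: "\<And>i. x i \<in> {-1, 0, 1}"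
  shows "(1 - a) ^ 4 \<le> quad_dens c x"
proof -
  have "1 - a \<le> 1 + c * of_int (x i)" "1 - a \<le> 1 - c * of_int (x i)" for i
    using x[of i] a by auto
  moreover from this have "0 \<le> 1 + c * of_int (x i)" "0 \<le> 1 - c * of_int (x i)" for i
    using a by (meson diff_ge_0_iff_ge less_imp_le order.trans)+
  ultimately have "(1 - a) * (1 - a) * (1 - a) * (1 - a) \<le> quad_dens c x"
    unfolding quad_dens_def using a by (intro mult_mono mult_nonneg_nonneg) simp_all
  thus ?thesis by (simp add: power4_eq_xxxx)
qed

text \<open>With the outputs of workers 3 and 4 negated, \<open>quad_dens\<close> is a product of
  factors \<open>1 + a * y i\<close>. The difference keeps the odd powers of \<open>a\<close>, whose
  coefficients are the elementary symmetric polynomials \<open>e1\<close> and \<open>e3\<close>;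
  this yields the factor \<open>a\<^sup>2\<close>. Keeping the sum of squares, not a constant, later
  yields a factor \<alpha>.\<close>

lemma quad_dens_diff:
  assumes a: "0 < a" "a < 1" and x: "\<And>i. x i \<in> {-1, 0, 1}"
  shows "(quad_dens a x - quad_dens (- a) x)\<^sup>2 \<le> 64 * a\<^sup>2 * (\<Sum>i\<in>{1, 2, 3, 4}. (of_int (x i))\<^sup>2)"
proof -
  define y :: "nat \<Rightarrow> real" where "y i = (if i \<in> {1, 2} then of_int (x i) else - of_int (x i))" for i
  define e1 where "e1 = y 1 + y 2 + y 3 + y 4"
  define e3 where "e3 = y 1 * y 2 * y 3 + y 1 * y 2 * y 4 + y 1 * y 3 * y 4 + y 2 * y 3 * y 4"
  define S where "S = (y 1)\<^sup>2 + (y 2)\<^sup>2 + (y 3)\<^sup>2 + (y 4)\<^sup>2"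
  have y: "y i \<in> {-1, 0, 1}" for i
    using x[of i] by (auto simp: y_def)
  \<comment> \<open>A check of the 81 possible output patterns.\<close>
  have e: "e1\<^sup>2 \<le> 4 * S \<and> e3\<^sup>2 \<le> 4 * S"
    using y[of 1] y[of 2] y[of 3] y[of 4] unfolding e1_def e3_def S_def
    by (elim insertE emptyE) simp_all
  have a3: "(a ^ 3)\<^sup>2 \<le> a\<^sup>2"
    using a power_decreasing[of 2 6 a] by (simp flip: power_mult)
  have "quad_dens a x - quad_dens (- a) x = 2 * (a * e1 + a ^ 3 * e3)"
    unfolding quad_dens_def e1_def e3_def y_def by (simp add: algebra_simps power3_eq_cube)
  hence "(quad_dens a x - quad_dens (- a) x)\<^sup>2 = 4 * (a * e1 + a ^ 3 * e3)\<^sup>2"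
    by (simp only: power_mult_distrib) simp
  also have "\<dots> \<le> 8 * (a\<^sup>2 * e1\<^sup>2 + (a ^ 3)\<^sup>2 * e3\<^sup>2)"
  proof -
    have "4 * (p + q)\<^sup>2 \<le> 8 * (p\<^sup>2 + q\<^sup>2)" for p q :: real
      using sum_squares_bound[of p q] by (simp add: power2_sum)
    from this[of "a * e1" "a ^ 3 * e3"] show ?thesis
      by (simp only: power_mult_distrib)
  qed
  also have "\<dots> \<le> 8 * (a\<^sup>2 * (4 * S) + a\<^sup>2 * (4 * S))"
    using e a3 by (intro mult_left_mono add_mono mult_mono) auto
  also have "\<dots> = 64 * a\<^sup>2 * S"
    by simp
  also have "S = (\<Sum>i\<in>{1, 2, 3, 4}. (of_int (x i))\<^sup>2)"
    by (simp add: S_def y_def)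
  finally show ?thesis .
qed

text \<open>Exchanging the two halves of a mixture changes it by half the product of the differences;
  writing \<open>V - W\<close> as \<open>(\<surd>V - \<surd>W) (\<surd>V + \<surd>W)\<close> cancels the denominator.\<close>

lemma swapped_mixture_bound:
  fixes U U' V W c :: real
  assumes c: "0 < c" "c \<le> U" "c \<le> U'" and V: "0 < V" "0 < W"
  defines "L \<equiv> (U * V + U' * W) / 2"
  shows "((U' * V + U * W) / 2 - L)\<^sup>2 / L \<le> (U - U')\<^sup>2 / c * (sqrt V - sqrt W)\<^sup>2"
proof -
  have "c * (V + W) / 2 \<le> L"
    \<comment> \<open>Both \<open>U\<close> and \<open>U'\<close> are at least
      \<open>c\<close>.\<close>
    unfolding L_def using c V by (auto simp: distrib_left intro!: divide_right_mono add_mono mult_right_mono)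
  hence L: "(V + W) / 2 \<le> L / c"
    using c by (simp add: field_simps)
  have "0 < L"
    unfolding L_def using c V by (auto intro!: add_pos_pos mult_pos_pos)
  have sum: "(sqrt V + sqrt W)\<^sup>2 \<le> 2 * (V + W)"
    using sum_squares_bound[of "sqrt V" "sqrt W"] V by (simp add: power2_sum)
  have "(U' * V + U * W) / 2 - L = - ((U - U') * (V - W)) / 2"
    by (simp add: L_def field_simps)
  also have "V - W = (sqrt V - sqrt W) * (sqrt V + sqrt W)"
    using V by (simp add: algebra_simps flip: power2_eq_square)
  finally have "((U' * V + U * W) / 2 - L)\<^sup>2 =
      (U - U')\<^sup>2 * (sqrt V - sqrt W)\<^sup>2 * ((sqrt V + sqrt W)\<^sup>2 / 4)"
    by (simp add: power_mult_distrib power_divide)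
  also have "\<dots> \<le> (U - U')\<^sup>2 * (sqrt V - sqrt W)\<^sup>2 * (L / c)"
  proof (rule mult_left_mono)
    show "(sqrt V + sqrt W)\<^sup>2 / 4 \<le> L / c"
      using sum L by linarith
  qed auto
  finally show ?thesis
    using \<open>0 < L\<close> by (simp add: field_simps)
qed

section \<open>Hellinger distance of the weak workers\<close>

lemma sqrt_prod: "sqrt (\<Prod>i\<in>A. f i) = (\<Prod>i\<in>A. sqrt (f i))"
  by (induction A rule: infinite_finite_induct) (simp_all add: real_sqrt_mult)

lemma tail_dens_pos:
  assumes "\<bar>r\<bar> < 1" "\<And>i. x i \<in> {-1, 0, 1}"
  shows "0 < tail_dens n r x"
  unfolding tail_dens_def
proof (intro prod_pos)
  show "0 < 1 + r * of_int (x i)" for i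
    using assms(1) assms(2)[of i] by auto
qed

text \<open>Apart from the independent weight of worker \<open>i\<close>, this is a squared
  Hellinger distance between the laws of the weak workers under the two ground truths. Affinities
  multiply over workers, so it grows at most linearly in \<open>n - 4\<close>; the weight supplies
  the second factor \<alpha>.\<close>

lemma tail_hellinger:
  assumes \<alpha>: "\<alpha> \<in> {0<..1}" and n: "n \<ge> 5" and r: "0 < r" "r < 1" and i: "i \<in> {1, 2, 3, 4}"
  shows "measure_pmf.expectation (obs_null n \<alpha>)
      (\<lambda>x. (of_int (x i))\<^sup>2 * (sqrt (tail_dens n r x) - sqrt (tail_dens n (- r) x))\<^sup>2)
    \<le> 2 * \<alpha>\<^sup>2 * real (n - 4) * r\<^sup>2"
proof -
  note [simp] = finite_obs_null[OF \<alpha>]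
  have int: "integrable (measure_pmf (obs_null n \<alpha>)) g" for g :: "_ \<Rightarrow> real"
    by (intro integrable_measure_pmf_finite) simp
  \<comment> \<open>The geometric mean of the two factors \<open>1 + r * y\<close> and
    \<open>1 - r * y\<close> of one weak worker.\<close>
  define s where "s = (\<lambda>y::int. sqrt (1 - r\<^sup>2 * (of_int y)\<^sup>2))"
  define m where "m = n - 4"
  have i': "i \<in> {1..n} - {5..n}" and J: "{5..n} \<subseteq> {1..n}"
    using i n by auto
  note E = expectation_sq_prod[OF \<alpha> J i']
  have r2: "r\<^sup>2 \<le> 1" "0 \<le> r\<^sup>2"
    using r by (auto simp: power_le_one)
  have "measure_pmf.expectation (obs_null n \<alpha>)
      (\<lambda>x. (of_int (x i))\<^sup>2 * (sqrt (tail_dens n r x) - sqrt (tail_dens n (- r) x))\<^sup>2) =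
    measure_pmf.expectation (obs_null n \<alpha>)
      (\<lambda>x. (of_int (x i))\<^sup>2 * tail_dens n r x + (of_int (x i))\<^sup>2 * tail_dens n (- r) x
        - 2 * ((of_int (x i))\<^sup>2 * (\<Prod>j\<in>{5..n}. s (x j))))"
  proof (intro integral_cong_AE AE_pmfI)
    fix x assume "x \<in> set_pmf (obs_null n \<alpha>)"
    hence x: "x i \<in> {-1, 0, 1}" for i
      by (rule obs_null_range[OF \<alpha>])
    have pos: "0 < tail_dens n r x" "0 < tail_dens n (- r) x"
      using r x by (auto intro!: tail_dens_pos)
    have "sqrt (tail_dens n r x) * sqrt (tail_dens n (- r) x) = sqrt (\<Prod>j\<in>{5..n}. 1 - r\<^sup>2 * (of_int (x j))\<^sup>2)"
      unfolding real_sqrt_mult[symmetric] tail_dens_def prod.distrib[symmetric]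
      by (intro arg_cong[of _ _ sqrt] prod.cong) (auto simp: power2_eq_square algebra_simps)
    also have "\<dots> = (\<Prod>j\<in>{5..n}. s (x j))"
      by (simp add: s_def sqrt_prod)
    finally have prod: "sqrt (tail_dens n r x) * sqrt (tail_dens n (- r) x) = (\<Prod>j\<in>{5..n}. s (x j))" .
    have H: "(sqrt (tail_dens n r x) - sqrt (tail_dens n (- r) x))\<^sup>2 =
        tail_dens n r x + tail_dens n (- r) x - 2 * (\<Prod>j\<in>{5..n}. s (x j))"
      using pos by (simp add: power2_diff mult.assoc prod)
    show "(of_int (x i))\<^sup>2 * (sqrt (tail_dens n r x) - sqrt (tail_dens n (- r) x))\<^sup>2 =
        (of_int (x i))\<^sup>2 * tail_dens n r x + (of_int (x i))\<^sup>2 * tail_dens n (- r) x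
        - 2 * ((of_int (x i))\<^sup>2 * (\<Prod>j\<in>{5..n}. s (x j)))"
      unfolding H by (simp add: algebra_simps)
  qed auto
  also have "\<dots> = measure_pmf.expectation (obs_null n \<alpha>) (\<lambda>x. (of_int (x i))\<^sup>2 * tail_dens n r x)
      + measure_pmf.expectation (obs_null n \<alpha>) (\<lambda>x. (of_int (x i))\<^sup>2 * tail_dens n (- r) x)
      - 2 * measure_pmf.expectation (obs_null n \<alpha>) (\<lambda>x. (of_int (x i))\<^sup>2 * (\<Prod>j\<in>{5..n}. s (x j)))"
    using int by (simp only: Bochner_Integration.integral_add Bochner_Integration.integral_diff
        Bochner_Integration.integral_mult_right_zero Bochner_Integration.integrable_add)
  \<comment> \<open>Every weak factor has null mean 1, which leaves the mean of the weight.\<close>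
  also have "measure_pmf.expectation (obs_null n \<alpha>) (\<lambda>x. (of_int (x i))\<^sup>2 * tail_dens n r x) = \<alpha>"
    unfolding tail_dens_def using r by (subst E) auto
  also have "measure_pmf.expectation (obs_null n \<alpha>) (\<lambda>x. (of_int (x i))\<^sup>2 * tail_dens n (- r) x) = \<alpha>"
    unfolding tail_dens_def using r by (subst E) auto
  also have "measure_pmf.expectation (obs_null n \<alpha>) (\<lambda>x. (of_int (x i))\<^sup>2 * (\<Prod>j\<in>{5..n}. s (x j)))
      = \<alpha> * (\<alpha> * sqrt (1 - r\<^sup>2) + (1 - \<alpha>)) ^ m"
    unfolding s_def using r2 by (subst E) (auto simp: m_def)
  \<comment> \<open>Bernoulli's inequality, after replacing \<open>sqrt (1 - r\<^sup>2)\<close> by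
    the smaller \<open>1 - r\<^sup>2\<close>.\<close>
  also have "\<alpha> + \<alpha> - 2 * (\<alpha> * (\<alpha> * sqrt (1 - r\<^sup>2) + (1 - \<alpha>)) ^ m) \<le> \<alpha> + \<alpha> - 2 * (\<alpha> * (1 - m * (\<alpha> * r\<^sup>2)))"
  proof -
    have "1 - r\<^sup>2 \<le> sqrt (1 - r\<^sup>2)"
      using r2 by (intro real_le_rsqrt) (simp add: power2_eq_square mult_left_le)
    hence "\<alpha> * (1 - r\<^sup>2) \<le> \<alpha> * sqrt (1 - r\<^sup>2)"
      using \<alpha> by (intro mult_left_mono) auto
    hence base: "1 + - (\<alpha> * r\<^sup>2) \<le> \<alpha> * sqrt (1 - r\<^sup>2) + (1 - \<alpha>)"
      by (simp add: algebra_simps)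
    have "\<alpha> * r\<^sup>2 \<le> 1"
      using \<alpha> r2 by (intro mult_le_one) auto
    hence "1 + real m * (- (\<alpha> * r\<^sup>2)) \<le> (1 + - (\<alpha> * r\<^sup>2)) ^ m"
      by (intro Bernoulli_inequality) auto
    also have "\<dots> \<le> (\<alpha> * sqrt (1 - r\<^sup>2) + (1 - \<alpha>)) ^ m"
      using base \<open>\<alpha> * r\<^sup>2 \<le> 1\<close> by (intro power_mono) auto
    finally show ?thesis
      using \<alpha> by (auto intro!: mult_left_mono)
  qed
  also have "\<dots> = 2 * \<alpha>\<^sup>2 * real (n - 4) * r\<^sup>2"
    by (simp add: m_def power2_eq_square algebra_simps)
  finally show ?thesis .
qed

subsection \<open>The lower bounds\<close>

text \<open>One \<open>K\<close> serves both ranges of \<open>a\<close>: from 1/2 on,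
  \<open>a ^ 4\<close> is bounded below; under 1/2 the null density ratio is bounded below and
  \<open>1 / (1 - a)\<close> is at least 1.\<close>

lemma lower_bound_T1:
  fixes est :: "(nat \<Rightarrow> nat \<Rightarrow> int) \<Rightarrow> nat \<Rightarrow> real"
  assumes n: "n \<ge> 3" and \<alpha>: "\<alpha> \<in> {0<..1}" and a: "a \<in> {0<..<1}" and b: "b \<le> 1"
    and \<epsilon>: "\<epsilon> \<in> {0<..<min a (min ((1 - a) / 2) (1 / 4))}" and \<delta>: "0 < \<delta>" "\<delta> < 1 / 4"
    and t: "real t * (1024 * \<alpha>\<^sup>2 * a ^ 4 * \<epsilon>\<^sup>2 / (1 - a)) \<le> ln (1 / (4 * \<delta>))"
  shows "\<exists>\<theta>\<in>Theta n a b. measure_pmf.prob (tasks_pmf n \<alpha> \<theta> t)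
           {\<omega>. linf_dist n (est (observations \<omega>)) \<theta> \<ge> \<epsilon>} \<ge> \<delta>"
proof -
  let ?\<theta> = "vec3 1 a a" and ?P0 = "obs_null n \<alpha>"
  let ?L = "obs_dens n ?\<theta>" and ?K = "1024 * \<alpha>\<^sup>2 * a ^ 4 * \<epsilon>\<^sup>2 / (1 - a)"
  have a': "0 < a" "a < 1" and \<epsilon>': "0 < \<epsilon>" "\<epsilon> < a" "2 * \<epsilon> < 1 - a" "\<epsilon> < 1 / 4"
    using a \<epsilon> by auto
  note [simp] = finite_obs_null[OF \<alpha>]
  have int: "integrable (measure_pmf ?P0) g" for g :: "_ \<Rightarrow> real"
    by (intro integrable_measure_pmf_finite) simp
  have range: "real_of_int (x i) \<in> {-1, 0, 1}" if "x \<in> set_pmf ?P0" for x i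
    using obs_null_range[OF \<alpha> that, of i] by auto
  have L: "?L x = 1 + a * (real_of_int (x 1) * real_of_int (x 2)) + a * (real_of_int (x 1) * real_of_int (x 3))
      + a * a * (real_of_int (x 2) * real_of_int (x 3))" for x
    using n by (simp add: obs_dens_vec3)
  have lower: "(1 - a)\<^sup>2 \<le> ?L x" if "x \<in> set_pmf ?P0" for x
    unfolding L using a' range[OF that] by (intro vec3_dens_lower) auto
  have pos: "0 < ?L x" if "x \<in> set_pmf ?P0" for x
    using lower[OF that] a' by (intro order.strict_trans2[OF _ lower[OF that]]) auto
  have \<theta>: "?\<theta> \<in> Theta n a b"
    using n a' b by (intro vec3_in_Theta) auto
  have sq: "measure_pmf.expectation ?P0 (\<lambda>x. (real_of_int (x i))\<^sup>2 * (real_of_int (x j))\<^sup>2) = \<alpha>\<^sup>2"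
    if "i \<in> {1, 2, 3}" "j \<in> {1, 2, 3}" "i \<noteq> j" for i j
    using n that by (intro expectation_sq_sq[OF \<alpha>]) auto
  show ?thesis
  proof (cases "a \<ge> 1 / 2")
    case True
    let ?\<theta>' = "vec3 1 (a + 2 * \<epsilon>) a"
    define h where "h = (\<lambda>x. 8 * \<epsilon>\<^sup>2 / (1 - a) * ((real_of_int (x 1))\<^sup>2 * (real_of_int (x 2))\<^sup>2 +
      (real_of_int (x 3))\<^sup>2 * (real_of_int (x (2::nat)))\<^sup>2))"
    have \<theta>': "?\<theta>' \<in> Theta n a b"
      using n a' b \<epsilon>' by (intro vec3_in_Theta) auto
    show ?thesis
    proof (rule two_parameters[OF \<alpha> \<theta> \<theta>' _ _ pos _ _ t \<delta>])
      fix x assume x: "x \<in> set_pmf ?P0"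
      let ?u = "real_of_int (x 1) * real_of_int (x 2) + a * (real_of_int (x 2) * real_of_int (x 3))"
      let ?S = "(real_of_int (x 1))\<^sup>2 * (real_of_int (x 2))\<^sup>2 + (real_of_int (x 3))\<^sup>2 * (real_of_int (x 2))\<^sup>2"
      have diff: "obs_dens n ?\<theta>' x - ?L x = 2 * \<epsilon> * ?u"
        using n by (simp add: obs_dens_vec3 algebra_simps)
      have "?u\<^sup>2 * (1 - a) \<le> 2 * ?L x * ?S"
        unfolding L using a' range[OF x] by (intro vec3_dens_upper) auto
      hence "?u\<^sup>2 / ?L x \<le> 2 * ?S / (1 - a)"
        using pos[OF x] a' by (simp add: field_simps)
      hence "4 * \<epsilon>\<^sup>2 * (?u\<^sup>2 / ?L x) \<le> 4 * \<epsilon>\<^sup>2 * (2 * ?S / (1 - a))"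
        by (intro mult_left_mono) auto
      moreover have "(2 * \<epsilon> * ?u)\<^sup>2 = 4 * \<epsilon>\<^sup>2 * ?u\<^sup>2"
        by (simp only: power_mult_distrib) simp
      moreover have "4 * \<epsilon>\<^sup>2 * (2 * ?S / (1 - a)) = h x"
        by (simp only: h_def) simp
      ultimately show "(obs_dens n ?\<theta>' x - ?L x)\<^sup>2 / ?L x \<le> h x"
        unfolding diff by (simp only: times_divide_eq_right)
    next
      have "measure_pmf.expectation ?P0 h = 16 * (\<epsilon>\<^sup>2 * \<alpha>\<^sup>2 / (1 - a))"
        using int sq[of 1 2] sq[of 3 2] unfolding h_def by simp
      \<comment> \<open>Since \<open>a ^ 4\<close> is at least 1/16, a constant 256 would do here;
        1024 is dictated by the other case.\<close>
      also have "\<dots> \<le> 1024 * a ^ 4 * (\<epsilon>\<^sup>2 * \<alpha>\<^sup>2 / (1 - a))"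
      proof (intro mult_right_mono)
        have "(1 / 2) ^ 4 \<le> a ^ 4"
          using True by (intro power_mono) auto
        thus "16 \<le> 1024 * a ^ 4" by (simp add: power_one_over)
      qed (use a' in auto)
      finally show "measure_pmf.expectation ?P0 h \<le> ?K"
        by (simp add: mult_ac)
    next
      show "2 * \<epsilon> \<le> \<bar>?\<theta> 2 - ?\<theta>' 2\<bar>" "2 \<in> {1..n}"
        using n \<epsilon>' by (auto simp: vec3_def)
    qed
  next
    case False
    \<comment> \<open>Worker 1 moves by \<open>2 * \<epsilon>\<close>, while dividing the other two
      reliabilities by \<open>q\<close> keeps their correlations with worker 1 equal to
      \<open>a\<close>.\<close>
    define q where "q = 1 - 2 * \<epsilon>"
    have q: "1 / 2 \<le> q" "q \<le> 1" "a \<le> q"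
      using \<epsilon>' by (auto simp: q_def)
    let ?\<theta>' = "vec3 q (a / q) (a / q)"
    define d where "d = a / q * (a / q) - a * a"
    define h where "h = (\<lambda>x. 4 * d\<^sup>2 * ((real_of_int (x 2))\<^sup>2 * (real_of_int (x (3::nat)))\<^sup>2))"
    have aq: "a \<le> a / q" "a / q \<le> 1"
      using q a' by (auto simp: field_simps mult_left_le)
    \<comment> \<open>The sum is at least \<open>1 - 2 * \<epsilon> + 2 * a\<close>, which exceeds 1
      because \<epsilon> is below \<open>a\<close>.\<close>
    have \<theta>': "?\<theta>' \<in> Theta n a b"
      using n a' b q aq \<epsilon>' by (intro vec3_in_Theta) (auto simp: q_def)
    have d: "0 \<le> d" "d \<le> 16 * (a\<^sup>2 * \<epsilon>)"
    proof -
      show "0 \<le> d"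
        unfolding d_def diff_ge_0_iff_ge using aq a' by (intro mult_mono) auto
      \<comment> \<open>\<open>d\<close> is
        \<open>a\<^sup>2 * (1 - q) * (1 + q) / q\<^sup>2\<close>; the bounds
        \<open>1 / q \<le> 2\<close> and \<open>1 + q \<le> 2\<close> with
        \<open>1 - q = 2 * \<epsilon>\<close> give the constant 16.\<close>
      have "1 / q * (1 / q) \<le> 2 * 2"
        using q by (intro mult_mono) (auto simp: field_simps)
      moreover have "(1 - q) * (1 + q) \<le> (1 - q) * 2"
        using q by (intro mult_left_mono) auto
      moreover have "(0::real) \<le> 2 * 2" by simp
      moreover have "0 \<le> (1 - q) * (1 + q)"
        using q by (intro mult_nonneg_nonneg) auto
      ultimately have "(1 / q * (1 / q)) * ((1 - q) * (1 + q)) \<le> (2 * 2) * ((1 - q) * 2)"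
        by (rule mult_mono)
      hence "a\<^sup>2 * ((1 / q * (1 / q)) * ((1 - q) * (1 + q))) \<le> a\<^sup>2 * ((2 * 2) * ((1 - q) * 2))"
        by (intro mult_left_mono) auto
      moreover have "d = a\<^sup>2 * ((1 / q * (1 / q)) * ((1 - q) * (1 + q)))"
        using q by (simp add: d_def field_simps power2_eq_square)
      ultimately show "d \<le> 16 * (a\<^sup>2 * \<epsilon>)"
        by (simp add: q_def mult_ac)
    qed
    show ?thesis
    proof (rule two_parameters[OF \<alpha> \<theta> \<theta>' _ _ pos _ _ t \<delta>])
      fix x assume x: "x \<in> set_pmf ?P0"
      let ?u = "real_of_int (x 2) * real_of_int (x 3)"
      have diff: "obs_dens n ?\<theta>' x - ?L x = d * ?u"
        using n q by (simp add: obs_dens_vec3 d_def algebra_simps)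
      \<comment> \<open>For \<open>a\<close> below 1/2 the density is at least 1/4.\<close>
      have "(1 / 2)\<^sup>2 \<le> (1 - a)\<^sup>2"
        using False by (intro power_mono) auto
      with lower[OF x] have "1 \<le> 4 * ?L x"
        by (simp add: power2_eq_square)
      hence "(d * ?u)\<^sup>2 * 1 \<le> (d * ?u)\<^sup>2 * (4 * ?L x)"
        by (intro mult_left_mono) auto
      hence "(d * ?u)\<^sup>2 / ?L x \<le> 4 * (d * ?u)\<^sup>2"
        using pos[OF x] by (simp add: field_simps)
      thus "(obs_dens n ?\<theta>' x - ?L x)\<^sup>2 / ?L x \<le> h x"
        unfolding diff h_def by (simp add: power_mult_distrib)
    next
      have "measure_pmf.expectation ?P0 h = 4 * d\<^sup>2 * \<alpha>\<^sup>2"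
        using int sq[of 2 3] unfolding h_def by simp
      also have "\<dots> \<le> 4 * (16 * (a\<^sup>2 * \<epsilon>))\<^sup>2 * \<alpha>\<^sup>2"
        using d by (intro mult_right_mono mult_left_mono power_mono) auto
      also have "\<dots> = 1024 * \<alpha>\<^sup>2 * a ^ 4 * \<epsilon>\<^sup>2"
        by (simp add: power_mult_distrib flip: power_mult)
      also have "\<dots> \<le> ?K"
        using a' by (simp add: field_simps)
      finally show "measure_pmf.expectation ?P0 h \<le> ?K" .
    next
      show "2 * \<epsilon> \<le> \<bar>?\<theta> 1 - ?\<theta>' 1\<bar>" "1 \<in> {1..n}"
        using n \<epsilon>' by (auto simp: vec3_def q_def)
    qed
  qed
qed

lemma lower_bound_T2:
  fixes est :: "(nat \<Rightarrow> nat \<Rightarrow> int) \<Rightarrow> nat \<Rightarrow> real"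
  assumes n: "n \<ge> 5" and \<alpha>: "\<alpha> \<in> {0<..1}" and a: "a \<in> {0<..<1}" and b: "b \<in> {0<..<1}"
    and \<epsilon>: "\<epsilon> \<le> a" and \<delta>: "0 < \<delta>" "\<delta> < 1 / 4"
    and t: "real t * (512 * \<alpha>\<^sup>2 * a\<^sup>2 * b\<^sup>2 / ((1 - a) ^ 4 * (real n - 4))) \<le> ln (1 / (4 * \<delta>))"
  shows "\<exists>\<theta>\<in>Theta n a b. measure_pmf.prob (tasks_pmf n \<alpha> \<theta> t)
           {\<omega>. linf_dist n (est (observations \<omega>)) \<theta> \<ge> \<epsilon>} \<ge> \<delta>"
proof -
  define m where "m = real (n - 4)"
  have m: "m \<ge> 1" "m = real n - 4"
    using n by (auto simp: m_def)
  \<comment> \<open>Spreading \<open>b\<close> evenly over the weak workers makes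
    \<open>B_par\<close> equal to \<open>b\<close>.\<close>
  define r where "r = b / m"
  have r: "0 < r" "r < 1"
    using b m by (auto simp: r_def field_simps)
  have a': "0 < a" "a < 1" "0 < (1 - a) ^ 4"
    using a by auto
  let ?\<theta> = "vec4 a r" and ?\<theta>' = "vec4 (- a) r" and ?P0 = "obs_null n \<alpha>"
  let ?H = "\<lambda>x. (sqrt (tail_dens n r x) - sqrt (tail_dens n (- r) x))\<^sup>2"
  define h where "h = (\<lambda>x. 64 * a\<^sup>2 / (1 - a) ^ 4 * (\<Sum>i\<in>{1, 2, 3, 4}. (real_of_int (x i))\<^sup>2 * ?H x))"
  note [simp] = finite_obs_null[OF \<alpha>]
  have int: "integrable (measure_pmf ?P0) g" for g :: "_ \<Rightarrow> real"
    by (intro integrable_measure_pmf_finite) simp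
  have \<theta>: "?\<theta> \<in> Theta n a b" and \<theta>': "?\<theta>' \<in> Theta n a b"
    using n a' r m by (auto intro!: vec4_in_Theta simp: r_def m_def)
  have quad: "(1 - a) ^ 4 \<le> quad_dens a x" "(1 - a) ^ 4 \<le> quad_dens (- a) x"
    and tail: "0 < tail_dens n r x" "0 < tail_dens n (- r) x" if "x \<in> set_pmf ?P0" for x
    using a' r obs_null_range[OF \<alpha> that] by (auto intro!: quad_dens_lower tail_dens_pos)
  note dens = obs_dens_vec4[OF n]
  have dens': "obs_dens n ?\<theta>' x =
      (quad_dens (- a) x * tail_dens n r x + quad_dens a x * tail_dens n (- r) x) / 2" for x
    unfolding dens by simp
  show ?thesis
  proof (rule two_parameters[OF \<alpha> \<theta> \<theta>' _ _ _ _ _ t \<delta>])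
    fix x assume x: "x \<in> set_pmf ?P0"
    have "0 < quad_dens a x" "0 < quad_dens (- a) x"
      using quad[OF x] a'(3) by linarith+
    thus "0 < obs_dens n ?\<theta> x"
      unfolding dens using tail[OF x] by (auto intro!: add_pos_pos mult_pos_pos)
    have "(obs_dens n ?\<theta>' x - obs_dens n ?\<theta> x)\<^sup>2 / obs_dens n ?\<theta> x
        \<le> (quad_dens a x - quad_dens (- a) x)\<^sup>2 / (1 - a) ^ 4 * ?H x"
      unfolding dens' unfolding dens using a' quad[OF x] tail[OF x] by (intro swapped_mixture_bound) auto
    also have "\<dots> \<le> 64 * a\<^sup>2 * (\<Sum>i\<in>{1, 2, 3, 4}. (of_int (x i))\<^sup>2) / (1 - a) ^ 4 * ?H x"
      using a' obs_null_range[OF \<alpha> x] by (intro mult_right_mono divide_right_mono quad_dens_diff) auto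
    also have "\<dots> = h x"
      unfolding h_def sum_distrib_right[symmetric] by simp
    finally show "(obs_dens n ?\<theta>' x - obs_dens n ?\<theta> x)\<^sup>2 / obs_dens n ?\<theta> x \<le> h x" .
  next
    have "measure_pmf.expectation ?P0 h = 64 * a\<^sup>2 / (1 - a) ^ 4 *
        (\<Sum>i\<in>{1, 2, 3, 4}. measure_pmf.expectation ?P0 (\<lambda>x. (real_of_int (x i))\<^sup>2 * ?H x))"
      unfolding h_def using int
      by (simp only: Bochner_Integration.integral_mult_right_zero Bochner_Integration.integral_sum)
    also have "\<dots> \<le> 64 * a\<^sup>2 / (1 - a) ^ 4 * (\<Sum>i\<in>{1, 2, 3, 4::nat}. 2 * \<alpha>\<^sup>2 * real (n - 4) * r\<^sup>2)"
      using a' by (intro mult_left_mono sum_mono tail_hellinger[OF \<alpha> n r]) auto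
    \<comment> \<open>The constant is 64 * 4 * 2. The even spread turns \<open>m * r\<^sup>2\<close>
      into \<open>b\<^sup>2 / m\<close>, hence the factor \<open>n - 4\<close> in the second
      bound.\<close>
    also have "\<dots> = 512 * \<alpha>\<^sup>2 * a\<^sup>2 * (m * r\<^sup>2) / (1 - a) ^ 4"
      by (simp add: m_def)
    also have "m * r\<^sup>2 = b\<^sup>2 / m"
      using m by (simp add: r_def power2_eq_square)
    finally show "measure_pmf.expectation ?P0 h
        \<le> 512 * \<alpha>\<^sup>2 * a\<^sup>2 * b\<^sup>2 / ((1 - a) ^ 4 * (real n - 4))"
      by (simp add: m(2) mult_ac)
  next
    show "2 * \<epsilon> \<le> \<bar>?\<theta> 1 - ?\<theta>' 1\<bar>" "1 \<in> {1..n}"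
      using n a' \<epsilon> by (auto simp: vec4_def)
  qed
qed

text \<open>Passes from a sample-size bound to the form \<open>t * K \<le> l\<close>, with
  \<open>K\<close> the reciprocal of the coefficient of \<open>l\<close>.\<close>

lemma le_divide_times:
  fixes t x y c l :: real
  assumes "t \<le> 1 / c * (x / y) * l" "0 < x" "0 < y" "0 < c"
  shows "t * (c * y / x) \<le> l"
proof -
  have "t * (c * y / x) \<le> (1 / c * (x / y) * l) * (c * y / x)"
    using assms by (intro mult_right_mono) auto
  thus ?thesis using assms by simp
qed

theorem theorem1:
  shows "\<exists>c1 c2 :: real. c1 > 0 \<and> c2 > 0 \<and>
    (\<forall>(n::nat) (\<alpha>::real) (a::real) (b::real) (\<epsilon>::real) (\<delta>::real).
       n \<ge> 3 \<longrightarrow> \<alpha> \<in> {0<..1} \<longrightarrow> a \<in> {0<..<1} \<longrightarrow> b \<in> {0<..<1} \<longrightarrow>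
       \<epsilon> \<in> {0<..<min a (min ((1 - a) / 2) (1 / 4))} \<longrightarrow> \<delta> \<in> {0<..<1 / 4} \<longrightarrow>
       (let T1 = c1 * ((1 - a) / (\<alpha>^2 * a^4 * \<epsilon>^2)) * ln (1 / (4 * \<delta>));
            T2 = c2 * ((1 - a)^4 * (real n - 4) / (\<alpha>^2 * a^2 * b^2)) * ln (1 / (4 * \<delta>))
        in \<forall>(t::nat) (est :: (nat \<Rightarrow> nat \<Rightarrow> int) \<Rightarrow> nat \<Rightarrow> real).
             t \<ge> 1 \<longrightarrow> real t \<le> max T1 T2 \<longrightarrow>
             (\<exists>\<theta>\<in>Theta n a b.
                measure_pmf.prob (tasks_pmf n \<alpha> \<theta> t)
                  {\<omega>. linf_dist n (est (observations \<omega>)) \<theta> \<ge> \<epsilon>} \<ge> \<delta>)))"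
proof (rule exI[of _ "1 / 1024"], rule exI[of _ "1 / 512"], intro conjI allI impI)
  \<comment> \<open>The witnesses are the reciprocals of the constants 1024 and 512 in the two
    chi-square bounds.\<close>
  fix n :: nat and \<alpha> a b \<epsilon> \<delta> :: real
  assume n: "n \<ge> 3" and \<alpha>: "\<alpha> \<in> {0<..1}" and a: "a \<in> {0<..<1}" and b: "b \<in> {0<..<1}"
    and \<epsilon>: "\<epsilon> \<in> {0<..<min a (min ((1 - a) / 2) (1 / 4))}" and \<delta>: "\<delta> \<in> {0<..<1 / 4}"
  define l where "l = ln (1 / (4 * \<delta>))"
  have l: "0 < l"
    using \<delta> by (simp add: l_def ln_gt_zero)
  have "\<exists>\<theta>\<in>Theta n a b. measure_pmf.prob (tasks_pmf n \<alpha> \<theta> t)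
          {\<omega>. linf_dist n (est (observations \<omega>)) \<theta> \<ge> \<epsilon>} \<ge> \<delta>"
    if t: "t \<ge> 1" "real t \<le> max (1 / 1024 * ((1 - a) / (\<alpha>\<^sup>2 * a ^ 4 * \<epsilon>\<^sup>2)) * l)
      (1 / 512 * ((1 - a) ^ 4 * (real n - 4) / (\<alpha>\<^sup>2 * a\<^sup>2 * b\<^sup>2)) * l)"
    for t :: nat and est :: "(nat \<Rightarrow> nat \<Rightarrow> int) \<Rightarrow> nat \<Rightarrow> real"
    using t(2) unfolding le_max_iff_disj
  proof
    assume "real t \<le> 1 / 1024 * ((1 - a) / (\<alpha>\<^sup>2 * a ^ 4 * \<epsilon>\<^sup>2)) * l"
    hence "real t * (1024 * (\<alpha>\<^sup>2 * a ^ 4 * \<epsilon>\<^sup>2) / (1 - a)) \<le> l"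
      using \<alpha> a \<epsilon> by (intro le_divide_times) auto
    thus ?thesis
      using n \<alpha> a b \<epsilon> \<delta> by (intro lower_bound_T1) (auto simp: l_def mult_ac)
  next
    assume T2: "real t \<le> 1 / 512 * ((1 - a) ^ 4 * (real n - 4) / (\<alpha>\<^sup>2 * a\<^sup>2 * b\<^sup>2)) * l"
    \<comment> \<open>For at most four workers the second threshold is at most 0, as
      \<open>real n - 4\<close> is a real difference, which \<open>t \<ge> 1\<close>
      excludes.\<close>
    have "n \<ge> 5"
    proof (rule ccontr)
      assume "\<not> n \<ge> 5"
      hence "(1 - a) ^ 4 * (real n - 4) \<le> 0"
        using a by (intro mult_nonneg_nonpos) auto
      hence Z: "(1 - a) ^ 4 * (real n - 4) / (\<alpha>\<^sup>2 * a\<^sup>2 * b\<^sup>2) \<le> 0"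
        by (rule divide_nonpos_nonneg) simp
      have "1 / 512 * ((1 - a) ^ 4 * (real n - 4) / (\<alpha>\<^sup>2 * a\<^sup>2 * b\<^sup>2)) * l \<le> 0"
        by (rule mult_nonpos_nonneg[OF mult_nonneg_nonpos[OF _ Z]]) (use l in simp_all)
      from order.trans[OF T2 this] t(1) show False by simp
    qed
    moreover from this have "real t * (512 * (\<alpha>\<^sup>2 * a\<^sup>2 * b\<^sup>2) / ((1 - a) ^ 4 * (real n - 4))) \<le> l"
      using T2 \<alpha> a b by (intro le_divide_times) auto
    ultimately show ?thesis
      using \<alpha> a b \<epsilon> \<delta> by (intro lower_bound_T2) (auto simp: l_def mult_ac)
  qed
  thus "let T1 = 1 / 1024 * ((1 - a) / (\<alpha>^2 * a^4 * \<epsilon>^2)) * ln (1 / (4 * \<delta>));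
            T2 = 1 / 512 * ((1 - a)^4 * (real n - 4) / (\<alpha>^2 * a^2 * b^2)) * ln (1 / (4 * \<delta>))
        in \<forall>(t::nat) (est :: (nat \<Rightarrow> nat \<Rightarrow> int) \<Rightarrow> nat \<Rightarrow> real).
             t \<ge> 1 \<longrightarrow> real t \<le> max T1 T2 \<longrightarrow>
             (\<exists>\<theta>\<in>Theta n a b.
                measure_pmf.prob (tasks_pmf n \<alpha> \<theta> t)
                  {\<omega>. linf_dist n (est (observations \<omega>)) \<theta> \<ge> \<epsilon>} \<ge> \<delta>)"
    unfolding Let_def l_def[symmetric] by blast
qed simp_all

end
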